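(* Let $\mathcal H$ be a real Hilbert space, let $f\in\Gamma_0(\mathcal H)$ be such that $\operatorname{lev}_{\leq 0}f\neq\varnothing$, and let $x\in\mathcal H$ with $f(x)>0$. Suppose that $f$ is twice Fréchet differentiable in a neighborhood of $x$. Then $G_f$ is single-valued near $x$, Fréchet differentiable at $x$, and for every $h\in\mathcal H$ $$\mathrm DG_f(x)h=h-\frac{\langle h,\nabla f(x)\rangle}{\|\nabla f(x)\|^2}\nabla f(x)-\frac{f(x)}{\|\nabla f(x)\|^2}\nabla^2f(x)h+\frac{2f(x)\langle\nabla f(x),\nabla^2f(x)h\rangle}{\|\nabla f(x)\|^4}\nabla f(x).$$
   Context: $\Gamma_0(\mathcal H)$ is the set of proper convex lower semicontinuous functions $\mathcal H\to]-\infty,+\infty]$; $\operatorname{lev}_{\leq 0}f=\{x: f(x)\leq 0\}$. $\partial f$ is the convex subdifferential. The subgradient projector $G_f:\mathcal H\to 2^{\mathcal H}$ is $G_fx=\{x\}$ if $f(x)\leq 0$ and $G_fx=\{x-\frac{f(x)}{\|u\|^2}u : u\in\partial f(x)\}$ if $f(x)>0$ (subgradients at points where $f>0$ are nonzero because $\operatorname{lev}_{\leq 0}f\neq\varnothing$); singletons are identified with their element. $\nabla^2 f(x):\mathcal H\to\mathcal H$ is the bounded linear operator which is the Fréchet derivative of $\nabla f$ at $x$, and $\mathrm D$ denotes the Fréchet derivative. *)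

theory Defs
  imports "HOL-Analysis.Analysis"
begin

text \<open>
  A real Hilbert space is a type of sort \<open>{real_inner, complete_space}\<close>. A function with values
  in \<open>]-\<infinity>, +\<infinity>]\<close> has type \<open>'a \<Rightarrow> ereal\<close>; the value \<open>-\<infinity>\<close> is excluded by \<open>proper_fun\<close>.
\<close>

definition proper_fun :: "('a \<Rightarrow> ereal) \<Rightarrow> bool" where
  "proper_fun f \<longleftrightarrow> (\<forall>x. f x \<noteq> -\<infinity>) \<and> (\<exists>x. f x \<noteq> \<infinity>)"

text \<open>
  The weights are strictly between 0 and 1, so no product \<open>0 * \<infinity>\<close> occurs; together with
  \<open>proper_fun\<close> no sum \<open>\<infinity> + (-\<infinity>)\<close> occurs either.
\<close>

definition convex_fun :: "('a::real_vector \<Rightarrow> ereal) \<Rightarrow> bool" where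
  "convex_fun f \<longleftrightarrow>
     (\<forall>x y. \<forall>t::real. 0 < t \<longrightarrow> t < 1 \<longrightarrow>
        f ((1 - t) *\<^sub>R x + t *\<^sub>R y) \<le> ereal (1 - t) * f x + ereal t * f y)"

definition lsc_fun :: "('a::topological_space \<Rightarrow> ereal) \<Rightarrow> bool" where
  "lsc_fun f \<longleftrightarrow> (\<forall>x. f x \<le> Liminf (nhds x) f)"

definition Gamma0 :: "('a::real_normed_vector \<Rightarrow> ereal) set" where
  "Gamma0 = {f. proper_fun f \<and> convex_fun f \<and> lsc_fun f}"

definition lev_le0 :: "('a \<Rightarrow> ereal) \<Rightarrow> 'a set" where
  "lev_le0 f = {x. f x \<le> 0}"

definition subdifferential :: "('a::real_inner \<Rightarrow> ereal) \<Rightarrow> 'a \<Rightarrow> 'a set" where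
  "subdifferential f x = {u. \<forall>y. ereal ((y - x) \<bullet> u) + f x \<le> f y}"

text \<open>
  \<open>real_of_ereal\<close> is only relevant where \<open>f x\<close> is finite: for proper \<open>f\<close> the subdifferential, and
  hence \<open>subgrad_proj f x\<close>, is empty where \<open>f x = \<infinity>\<close>.
\<close>

definition subgrad_proj :: "('a::real_inner \<Rightarrow> ereal) \<Rightarrow> 'a \<Rightarrow> 'a set" where
  "subgrad_proj f x =
     (if f x \<le> 0 then {x}
      else {x - (real_of_ereal (f x) / (norm u)\<^sup>2) *\<^sub>R u | u. u \<in> subdifferential f x})"

definition gradient :: "('a::real_inner \<Rightarrow> ereal) \<Rightarrow> 'a \<Rightarrow> 'a" where
  "gradient f x = (THE g. GDERIV (\<lambda>y. real_of_ereal (f y)) x :> g)"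

definition hessian :: "('a::real_inner \<Rightarrow> ereal) \<Rightarrow> 'a \<Rightarrow> 'a \<Rightarrow> 'a" where
  "hessian f x = frechet_derivative (gradient f) (at x)"

text \<open>
  Finiteness of \<open>f\<close> is required explicitly, since \<open>real_of_ereal \<infinity> = 0\<close>. On a Hilbert space,
  differentiability makes \<open>gradient f y\<close> the Riesz representer of the derivative at \<open>y\<close>.
\<close>

definition twice_frechet_differentiable_near ::
    "('a::real_inner \<Rightarrow> ereal) \<Rightarrow> 'a \<Rightarrow> bool" where
  "twice_frechet_differentiable_near f x \<longleftrightarrow>
     (\<exists>U. open U \<and> x \<in> U \<and>
        (\<forall>y\<in>U. \<bar>f y\<bar> \<noteq> \<infinity> \<and>
               (\<lambda>z. real_of_ereal (f z)) differentiable (at y) \<and>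
               gradient f differentiable (at y)))"

end

theory Submission
  imports Defs
begin

text \<open>
  Where \<open>f\<close> is positive and differentiable, convexity forces the subdifferential to be the singleton
  of the gradient, and the gradient is nonzero because \<open>f\<close> has a nonpositive value somewhere. So near
  \<open>x\<close> the subgradient projector is \<open>y \<mapsto> y - (f(y) / \<parallel>\<nabla>f(y)\<parallel>\<^sup>2) \<nabla>f(y)\<close>, which is differentiated by
  the product and quotient rules.
\<close>

text \<open>
  The representer is obtained by minimising the quadratic functional \<open>\<parallel>v\<parallel>\<^sup>2 - 2 L(v)\<close>: by the
  parallelogram identity, minimising sequences are Cauchy.
\<close>

lemma riesz_representation:
  fixes L :: "'a::{real_inner, complete_space} \<Rightarrow> real"
  assumes "bounded_linear L"
  obtains v where "\<And>h. L h = h \<bullet> v"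
proof -
  interpret L: bounded_linear L by fact
  define J where "J v = v \<bullet> v - 2 * L v" for v
  obtain K where K: "\<And>v. norm (L v) \<le> norm v * K"
    using L.bounded by blast
  have J_lower: "- (K * K) \<le> J v" for v
  proof -
    have "L v \<le> norm v * K" using K[of v] by simp
    moreover have "0 \<le> (norm v - K)\<^sup>2" by simp
    ultimately show ?thesis
      by (simp add: J_def power2_eq_square algebra_simps flip: power2_norm_eq_inner)
  qed
  define m where "m = Inf (range J)"
  have bdd: "bdd_below (range J)"
    using J_lower by (auto intro!: bdd_belowI)
  have m_le: "m \<le> J v" for v
    unfolding m_def by (rule cInf_lower) (use bdd in auto)
  have "\<exists>v. J v < m + 1 / Suc n" for n
    using cInf_lessD[of "range J" "m + 1 / Suc n"] by (auto simp: m_def)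
  then obtain V where V: "\<And>n. J (V n) < m + 1 / Suc n" by metis
  \<comment> \<open>The linear parts cancel in the midpoint identity, leaving only
    \<open>norm (v - w)\<close>. Since \<open>m\<close> bounds \<open>J\<close> below at the
    midpoint, the distance is controlled by how far \<open>J (V i)\<close> and
    \<open>J (V j)\<close> exceed \<open>m\<close>.\<close>
  have gap: "(norm (V i - V j))\<^sup>2 \<le> 2 * (1 / Suc i + 1 / Suc j)" for i j
  proof -
    have "J v + J w - 2 * J ((1/2) *\<^sub>R (v + w)) = (norm (v - w))\<^sup>2 / 2" for v w
      unfolding J_def power2_norm_eq_inner
      by (simp add: L.add L.scaleR inner_add_left inner_add_right inner_diff_left
          inner_diff_right inner_commute field_simps)
    from this[of "V i" "V j"] show ?thesis
      using V[of i] V[of j] m_le[of "(1/2) *\<^sub>R (V i + V j)"] by simp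
  qed
  have "Cauchy V"
  proof (rule metric_CauchyI)
    fix e :: real assume "0 < e"
    \<comment> \<open>Each of the two reciprocals stays below a quarter of the squared tolerance,
      and \<open>gap\<close> doubles their sum.\<close>
    then obtain N where N: "1 / Suc N < e\<^sup>2 / 4"
      using nat_approx_posE[of "e\<^sup>2 / 4"] by auto
    have "dist (V i) (V j) < e" if "N \<le> i" "N \<le> j" for i j
    proof -
      have "1 / real (Suc i) + 1 / real (Suc j) \<le> 1 / real (Suc N) + 1 / real (Suc N)"
        using that by (intro add_mono frac_le) auto
      also have "\<dots> < e\<^sup>2 / 2"
        using N by argo
      finally have "(norm (V i - V j))\<^sup>2 < e\<^sup>2"
        using gap[of i j] by argo
      then show ?thesis
        using \<open>0 < e\<close> by (simp add: dist_norm power2_less_imp_less)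
    qed
    then show "\<exists>N. \<forall>i\<ge>N. \<forall>j\<ge>N. dist (V i) (V j) < e" by blast
  qed
  then obtain v where v: "V \<longlonglongrightarrow> v"
    using Cauchy_convergent convergent_def by blast
  have "(\<lambda>n. J (V n)) \<longlonglongrightarrow> J v"
    unfolding J_def by (intro tendsto_intros L.tendsto v)
  moreover have "(\<lambda>n. m + 1 / Suc n) \<longlonglongrightarrow> m + 0"
    by (intro tendsto_intros LIMSEQ_Suc lim_1_over_n)
  ultimately have "J v \<le> m + 0"
    by (rule LIMSEQ_le) (use V less_imp_le in blast)
  then have J_min: "J v \<le> J w" for w
    using m_le[of w] by simp
  have "L h = h \<bullet> v" for h
  proof (cases "h = 0")
    case False
    define c where "c = h \<bullet> v - L h"
    \<comment> \<open>This \<open>t\<close> minimises the quadratic polynomial that \<open>J\<close>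
      becomes on the line through \<open>v\<close> in direction \<open>h\<close>. The minimum lies
      below \<open>J v\<close> by \<open>c * c / (h \<bullet> h)\<close>, so minimality of
      \<open>v\<close> forces \<open>c = 0\<close>.\<close>
    define t where "t = - c / (h \<bullet> h)"
    have hh: "h \<bullet> h > 0" using False by simp
    have "J (v + t *\<^sub>R h) = J v + 2 * t * c + t * t * (h \<bullet> h)"
      by (simp add: J_def c_def L.add L.scaleR inner_add_left inner_add_right
          inner_commute algebra_simps)
    also have "2 * t * c + t * t * (h \<bullet> h) = - (c * c) / (h \<bullet> h)"
      using hh by (simp add: t_def field_simps)
    then have "J v + 2 * t * c + t * t * (h \<bullet> h) = J v - (c * c) / (h \<bullet> h)" by simp
    finally have "(c * c) / (h \<bullet> h) \<le> 0"
      using J_min[of "v + t *\<^sub>R h"] by simp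
    then have "c * c \<le> 0"
      using hh by (simp add: divide_le_0_iff)
    then have "c = 0" by (auto simp: mult_le_0_iff)
    then show ?thesis by (simp add: c_def)
  qed (simp add: L.zero)
  then show thesis by (rule that)
qed

text \<open>As \<open>gradient\<close> is a definite description, both existence and uniqueness of a
  representer are required. Riesz representation, and hence completeness, gives the first;
  uniqueness of the derivative gives the second.\<close>

lemma GDERIV_gradient:
  fixes f :: "'a::{real_inner, complete_space} \<Rightarrow> ereal"
  assumes "(\<lambda>z. real_of_ereal (f z)) differentiable (at y)"
  shows "GDERIV (\<lambda>z. real_of_ereal (f z)) y :> gradient f y"
proof -
  from assms obtain D where D: "((\<lambda>z. real_of_ereal (f z)) has_derivative D) (at y)"
    by (auto simp: differentiable_def)
  obtain g where "\<And>h. D h = h \<bullet> g"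
    using riesz_representation[OF has_derivative_bounded_linear[OF D]] by blast
  then have "D = (\<lambda>h. h \<bullet> g)" by auto
  with D have g: "GDERIV (\<lambda>z. real_of_ereal (f z)) y :> g"
    by (simp add: gderiv_def)
  have "gradient f y = g"
    unfolding gradient_def
  proof (rule the_equality)
    fix g' assume "GDERIV (\<lambda>z. real_of_ereal (f z)) y :> g'"
    then have "(\<lambda>h. h \<bullet> g') = (\<lambda>h. h \<bullet> g)"
      using g unfolding gderiv_def by (rule has_derivative_unique)
    then have "\<forall>h. h \<bullet> g' = h \<bullet> g" by (rule fun_eq_iff[THEN iffD1])
    then show "g' = g" by (simp only: vector_eq_ldot)
  qed (fact g)
  with g show ?thesis by simp
qed

text \<open>For a subgradient \<open>u\<close>, the map
  \<open>z \<mapsto> F z - (z - y) \<bullet> u\<close> has a local minimum at \<open>y\<close>, so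
  its derivative there vanishes and \<open>u = g\<close>. Conversely, convexity bounds the
  difference quotients of \<open>f\<close> along the segment from \<open>y\<close> to
  \<open>z\<close>, and their limit is the subgradient inequality for \<open>g\<close>. Finiteness
  near \<open>y\<close> ties \<open>real_of_ereal\<close> to the actual values of
  \<open>f\<close>.\<close>

lemma subdifferential_GDERIV:
  fixes f :: "'a::real_inner \<Rightarrow> ereal"
  assumes "proper_fun f" "convex_fun f"
    and fin: "\<forall>\<^sub>F z in nhds y. \<bar>f z\<bar> \<noteq> \<infinity>"
    and g: "GDERIV (\<lambda>z. real_of_ereal (f z)) y :> g"
  shows "subdifferential f y = {g}"
proof -
  define F where "F z = real_of_ereal (f z)" for z
  have fy: "f y = ereal (F y)"
    using eventually_nhds_x_imp_x[OF fin] by (auto simp: F_def ereal_real)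
  have F: "(F has_derivative (\<lambda>h. h \<bullet> g)) (at y)"
    using g by (simp add: gderiv_def F_def[abs_def])
  have "u = g" if u: "u \<in> subdifferential f y" for u
  proof -
    obtain d where d: "0 < d" "\<And>z. dist z y < d \<Longrightarrow> \<bar>f z\<bar> \<noteq> \<infinity>"
      using fin by (auto simp: eventually_nhds_metric)
    have "F y - (y - y) \<bullet> u \<le> F z - (z - y) \<bullet> u" if "z \<in> ball y d" for z
    proof -
      have "f z = ereal (F z)"
        using d(2)[of z] that by (auto simp: F_def ereal_real dist_commute)
      moreover have "ereal ((z - y) \<bullet> u) + f y \<le> f z"
        using u by (simp add: subdifferential_def)
      ultimately show ?thesis by (simp add: fy)
    qed
    moreover have "((\<lambda>z. F z - (z - y) \<bullet> u) has_derivative (\<lambda>h. h \<bullet> g - h \<bullet> u)) (at y)"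
      by (auto intro!: derivative_eq_intros F)
    ultimately have "(\<lambda>h. h \<bullet> g - h \<bullet> u) = (\<lambda>h. 0)"
      using d(1) by (intro differential_zero_maxmin[of y "ball y d"]) auto
    then have "\<forall>h. h \<bullet> u = h \<bullet> g" by (simp add: fun_eq_iff)
    then show ?thesis by (simp only: vector_eq_ldot)
  qed
  moreover have "g \<in> subdifferential f y"
    unfolding subdifferential_def
  proof (intro CollectI allI)
    fix z
    show "ereal ((z - y) \<bullet> g) + f y \<le> f z"
    \<comment> \<open>The point \<open>z\<close> may be far from \<open>y\<close>, so
      \<open>f z\<close> can be infinite: the inequality is then trivial for
      \<open>\<infinity>\<close>, while \<open>proper_fun\<close> excludes
      \<open>-\<infinity>\<close>.\<close>
    proof (cases "f z")
      case (real r)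
      define c where "c t = y + t *\<^sub>R (z - y)" for t
      have c: "(c has_derivative (\<lambda>t. t *\<^sub>R (z - y))) (at 0)"
        unfolding c_def by (auto intro!: derivative_eq_intros)
      have c0: "c 0 = y" by (simp add: c_def)
      have "((\<lambda>t. F (c t)) has_derivative (\<lambda>t. (t *\<^sub>R (z - y)) \<bullet> g)) (at 0)"
        using has_derivative_compose[OF c, of F "\<lambda>h. h \<bullet> g"] F c0 by simp
      then have "((\<lambda>t. F (c t)) has_real_derivative ((z - y) \<bullet> g)) (at 0)"
        by (simp add: has_field_derivative_def mult_commute_abs)
      then have "((\<lambda>t. (F (c t) - F y) / t) \<longlongrightarrow> (z - y) \<bullet> g) (at_right 0)"
        using c0 by (auto simp: DERIV_def intro: tendsto_mono[OF at_le])
      moreover have "\<forall>\<^sub>F t in at_right 0. (F (c t) - F y) / t \<le> r - F y"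
      proof -
        have "isCont c 0"
          using c by (rule has_derivative_continuous)
        then have "(c \<longlongrightarrow> y) (at_right 0)"
          using c0 by (auto simp: isCont_def intro: tendsto_mono[OF at_le])
        then have "\<forall>\<^sub>F t in at_right 0. \<bar>f (c t)\<bar> \<noteq> \<infinity>"
          by (rule filterlim_iff[THEN iffD1, rule_format, OF _ fin])
        moreover have "\<forall>\<^sub>F t in at_right 0. t \<in> {0<..<1::real}"
          by (rule eventually_at_right_real) simp
        ultimately show ?thesis
        proof eventually_elim
          case (elim t)
          have "c t = (1 - t) *\<^sub>R y + t *\<^sub>R z"
            by (simp add: c_def algebra_simps)
          then have "f (c t) \<le> ereal (1 - t) * f y + ereal t * f z"
            using assms(2) elim by (simp add: convex_fun_def)
          moreover have "f (c t) = ereal (F (c t))"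
            using elim(1) by (simp add: F_def ereal_real)
          ultimately have "F (c t) \<le> (1 - t) * F y + t * r"
            by (simp add: fy real)
          then show ?case
            using elim by (simp add: field_simps)
        qed
      qed
      ultimately have "(z - y) \<bullet> g \<le> r - F y"
        by (rule tendsto_upperbound) simp
      then show ?thesis by (simp add: fy real)
    qed (use assms(1) in \<open>auto simp: proper_fun_def\<close>)
  qed
  ultimately show ?thesis by blast
qed

text \<open>A zero subgradient would make \<open>y\<close> a global minimiser, so the positive
  number \<open>f y\<close> would be at most a nonpositive value of \<open>f\<close>.\<close>

lemma subgradient_nonzero:
  assumes "lev_le0 f \<noteq> {}" "f y > 0" "u \<in> subdifferential f y"
  shows "u \<noteq> 0"
proof
  assume "u = 0"
  obtain z where z: "f z \<le> 0" using assms(1) by (auto simp: lev_le0_def)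
  have "ereal ((z - y) \<bullet> u) + f y \<le> f z"
    using assms(3) by (simp add: subdifferential_def)
  with \<open>u = 0\<close> z assms(2) show False by (simp add: zero_ereal_def[symmetric])
qed

text \<open>Writing the squared norm as \<open>g y \<bullet> g y\<close> makes the product and
  quotient rules applicable without differentiating the norm itself.\<close>

lemma has_derivative_normalized_step:
  fixes F :: "'a::real_inner \<Rightarrow> real" and g H :: "'a \<Rightarrow> 'a"
  assumes F: "GDERIV F x :> g x" and g: "(g has_derivative H) (at x)" and "g x \<noteq> 0"
  shows "((\<lambda>y. y - (F y / (norm (g y))\<^sup>2) *\<^sub>R g y) has_derivative
          (\<lambda>h. h - ((h \<bullet> g x) / (norm (g x))\<^sup>2) *\<^sub>R g x
                 - (F x / (norm (g x))\<^sup>2) *\<^sub>R H h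
                 + (2 * F x * (g x \<bullet> H h) / (norm (g x)) ^ 4) *\<^sub>R g x)) (at x)"
proof -
  have F': "(F has_derivative (\<lambda>h. h \<bullet> g x)) (at x)"
    using F by (simp add: gderiv_def)
  define N where "N = g x \<bullet> g x"
  have N: "N \<noteq> 0" using \<open>g x \<noteq> 0\<close> by (simp add: N_def)
  have norm2: "(norm (g x))\<^sup>2 = N"
    by (simp add: N_def power2_norm_eq_inner)
  \<comment> \<open>The fourth power in the formula is the squared denominator of the quotient
    rule.\<close>
  have "norm (g x) ^ 4 = ((norm (g x))\<^sup>2)\<^sup>2" by simp
  then have norm4: "norm (g x) ^ 4 = N * N"
    unfolding norm2 by (simp only: power2_eq_square)
  have "((\<lambda>y. g y \<bullet> g y) has_derivative (\<lambda>h. 2 * (g x \<bullet> H h))) (at x)"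
    using has_derivative_inner[OF g g] by (simp add: inner_commute)
  from has_derivative_divide[OF F' this]
  have quot: "((\<lambda>y. F y / (g y \<bullet> g y)) has_derivative
      (\<lambda>h. (h \<bullet> g x) / N - 2 * F x * (g x \<bullet> H h) / (N * N))) (at x)"
    using N by (simp add: N_def[symmetric] field_simps)
  have "((\<lambda>y. y - (F y / (g y \<bullet> g y)) *\<^sub>R g y) has_derivative
      (\<lambda>h. h - ((F x / N) *\<^sub>R H h +
        ((h \<bullet> g x) / N - 2 * F x * (g x \<bullet> H h) / (N * N)) *\<^sub>R g x))) (at x)"
    using has_derivative_diff[OF has_derivative_ident has_derivative_scaleR[OF quot g]]
    by (simp add: N_def)
  then show ?thesis
    unfolding norm2 norm4 by (simp add: power2_norm_eq_inner algebra_simps)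
qed

theorem proposition3p7:
  fixes f :: "'a::{real_inner, complete_space} \<Rightarrow> ereal" and x :: 'a
  assumes "f \<in> Gamma0"
    and "lev_le0 f \<noteq> {}"
    and "f x > 0"
    and "twice_frechet_differentiable_near f x"
  shows "(\<forall>\<^sub>F y in nhds x. is_singleton (subgrad_proj f y)) \<and>
         (\<lambda>y. the_elem (subgrad_proj f y)) differentiable (at x) \<and>
         (\<forall>h. frechet_derivative (\<lambda>y. the_elem (subgrad_proj f y)) (at x) h =
            h - ((h \<bullet> gradient f x) / (norm (gradient f x))\<^sup>2) *\<^sub>R gradient f x
              - (real_of_ereal (f x) / (norm (gradient f x))\<^sup>2) *\<^sub>R hessian f x h
              + (2 * real_of_ereal (f x) * (gradient f x \<bullet> hessian f x h)
                   / (norm (gradient f x)) ^ 4) *\<^sub>R gradient f x)"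
proof -
  define F where "F = (\<lambda>y. real_of_ereal (f y))"
  \<comment> \<open>An explicit single-valued map, to be identified with the projector near
    \<open>x\<close> and differentiated in its place.\<close>
  define P where "P y = y - (F y / (norm (gradient f y))\<^sup>2) *\<^sub>R gradient f y" for y
  from assms(4) obtain U where U: "open U" "x \<in> U"
    and fin: "\<And>y. y \<in> U \<Longrightarrow> \<bar>f y\<bar> \<noteq> \<infinity>"
    and diff: "\<And>y. y \<in> U \<Longrightarrow> F differentiable (at y)"
    and diff2: "\<And>y. y \<in> U \<Longrightarrow> gradient f differentiable (at y)"
    unfolding twice_frechet_differentiable_near_def F_def[symmetric] by (elim exE conjE) metis
  have ev_U: "\<forall>\<^sub>F z in nhds y. z \<in> U" if "y \<in> U" for y
    using U(1) that by (rule eventually_nhds_in_open)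
  have gderiv: "GDERIV F y :> gradient f y" if "y \<in> U" for y
    using diff[OF that] unfolding F_def by (rule GDERIV_gradient)
  have subdiff: "subdifferential f y = {gradient f y}" if "y \<in> U" for y
  proof (rule subdifferential_GDERIV)
    show "proper_fun f" "convex_fun f" using assms(1) by (auto simp: Gamma0_def)
    show "\<forall>\<^sub>F z in nhds y. \<bar>f z\<bar> \<noteq> \<infinity>"
      using ev_U[OF that] by eventually_elim (rule fin)
    show "GDERIV (\<lambda>z. real_of_ereal (f z)) y :> gradient f y"
      using gderiv[OF that] unfolding F_def .
  qed
  have f_eq: "f y = ereal (F y)" if "y \<in> U" for y
    using fin[OF that] by (simp add: F_def ereal_real)
  \<comment> \<open>Lower semicontinuity is not invoked: differentiability makes \<open>F\<close>
    continuous at \<open>x\<close>, so positivity spreads to a neighborhood and the second branch of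
    \<open>subgrad_proj\<close> applies there.\<close>
  have "isCont F x"
    using diff[OF U(2)] by (rule differentiable_imp_continuous_within)
  then have "(F \<longlongrightarrow> F x) (nhds x)"
    by (simp add: isCont_def tendsto_at_iff_tendsto_nhds)
  moreover have "0 < F x" using assms(3) f_eq[OF U(2)] by simp
  ultimately have "\<forall>\<^sub>F y in nhds x. 0 < F y" by (rule order_tendstoD(1))
  with ev_U[OF U(2)] have proj: "\<forall>\<^sub>F y in nhds x. subgrad_proj f y = {P y}"
    by eventually_elim (simp add: subgrad_proj_def subdiff f_eq P_def)
  \<comment> \<open>The quotient rule asks for a nonzero denominator at \<open>x\<close> itself,
    where the gradient is a subgradient and \<open>f\<close> is positive.\<close>
  have "gradient f x \<noteq> 0"
    using subgradient_nonzero[OF assms(2,3)] subdiff[OF U(2)] by simp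
  moreover have "(gradient f has_derivative hessian f x) (at x)"
    using diff2[OF U(2)] by (simp add: hessian_def[abs_def] frechet_derivative_works[symmetric])
  ultimately have "(P has_derivative
      (\<lambda>h. h - ((h \<bullet> gradient f x) / (norm (gradient f x))\<^sup>2) *\<^sub>R gradient f x
              - (F x / (norm (gradient f x))\<^sup>2) *\<^sub>R hessian f x h
              + (2 * F x * (gradient f x \<bullet> hessian f x h)
                   / (norm (gradient f x)) ^ 4) *\<^sub>R gradient f x)) (at x)"
    (is "(P has_derivative ?D) _")
    unfolding P_def by (intro has_derivative_normalized_step gderiv U(2))
  \<comment> \<open>Transferring the derivative from \<open>P\<close> to the projector takes
    agreement on a punctured neighborhood and also at \<open>x\<close>; \<open>nhds\<close> supplies
    both.\<close>
  moreover have "\<forall>\<^sub>F y in nhds x. P y = the_elem (subgrad_proj f y)"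
    using proj by eventually_elim simp
  then have "\<forall>\<^sub>F y in at x. P y = the_elem (subgrad_proj f y)"
      "P x = the_elem (subgrad_proj f x)"
    unfolding eventually_nhds_conv_at by blast+
  ultimately have D: "((\<lambda>y. the_elem (subgrad_proj f y)) has_derivative ?D) (at x)"
    by (rule has_derivative_transform_eventually) simp
  have "\<forall>\<^sub>F y in nhds x. is_singleton (subgrad_proj f y)"
    using proj by eventually_elim simp
  with D show ?thesis
    unfolding frechet_derivative_at[OF D, symmetric] F_def
    by (auto simp: differentiable_def)
qed

end
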